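(* There is an absolute constant $c>0$ such that for every set $L$ of $n$ lines in $\mathbb{R}^3$, the intersection graph $G$ of $L$ has a clique of size at least $c\,n^{1/3}$ or an independent set of size at least $c\,n^{1/3}$.
   Context: The intersection graph of a set $L$ of lines in $\mathbb{R}^3$ is the graph with vertex set $L$ in which two distinct lines are adjacent if and only if they intersect (share a point). Parallel distinct lines do not intersect. *)

theory Defs
  imports "HOL-Analysis.Analysis" "HOL-Library.Ramsey"
begin

definition is_line :: "'a::euclidean_space set \<Rightarrow> bool" where
  "is_line l \<longleftrightarrow> affine l \<and> aff_dim l = 1"

lemma is_line_iff: "is_line l \<longleftrightarrow> (\<exists>a v. v \<noteq> 0 \<and> l = range (\<lambda>t::real. a + t *\<^sub>R v))"
proof
  assume l: "is_line l"
  then obtain B where B: "\<not> affine_dependent B" "affine hull B = affine hull l"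
      "int (card B) = aff_dim l + 1"
    using aff_dim_basis_exists by (metis of_nat_eq_iff)
  then have "card B = 2"
    using l by (simp add: is_line_def)
  then obtain a b where ab: "B = {a, b}" "a \<noteq> b"
    by (meson card_2_iff)
  have "l = affine hull {a, b}"
    using l B ab by (metis is_line_def affine_hull_eq)
  also have "\<dots> = range (\<lambda>t::real. a + t *\<^sub>R (b - a))"
    by (simp add: affine_hull_2_alt)
  finally show "\<exists>a v. v \<noteq> 0 \<and> l = range (\<lambda>t::real. a + t *\<^sub>R v)"
    using ab by (metis eq_iff_diff_eq_0)
next
  assume "\<exists>a v. v \<noteq> 0 \<and> l = range (\<lambda>t::real. a + t *\<^sub>R v)"
  then obtain a v where v: "v \<noteq> 0" and l: "l = range (\<lambda>t::real. a + t *\<^sub>R v)"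
    by blast
  have l': "l = affine hull {a, a + v}"
    by (simp add: affine_hull_2_alt l)
  then show "is_line l"
    using v by (simp add: is_line_def aff_dim_2)
qed

text \<open>Edge set of the intersection graph with vertex set \<open>L\<close>, in the format of the
  predicates \<^const>\<open>clique\<close> and \<^const>\<open>indep\<close>.\<close>

definition intersection_graph :: "'a set set \<Rightarrow> 'a set set set" where
  "intersection_graph L = {{l, m} | l m. l \<in> L \<and> m \<in> L \<and> l \<noteq> m \<and> l \<inter> m \<noteq> {}}"

end

theory Submission
  imports Defs
begin

text \<open>Let \<open>k\<close> bound the sizes of all cliques and independent sets. A line meeting a fixed line
  \<open>l\<close> is described by its point on \<open>l\<close>, its plane through \<open>l\<close>, and its direction, and two such lines
  with different points on \<open>l\<close> meet only if they share the plane and differ in direction. At most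
  \<open>k\<close> of the lines share a point and at most \<open>k\<close> directions occur in a plane. In a largest family
  of lines with distinct points and one direction per plane, swapping the members in one plane for
  another direction gains nothing; summing this over all directions and planes shows that \<open>l\<close>
  meets at most \<open>2 k\<^sup>2\<close> lines. A largest independent set dominates the graph, so
  \<open>n \<le> k (2 k\<^sup>2 + 1) \<le> 3 k\<^sup>3\<close>.\<close>

section \<open>Exchange argument for compatible families\<close>

text \<open>The functions \<open>p\<close>, \<open>q\<close> and \<open>d\<close> stand for the
  point on \<open>l\<close>, the plane through \<open>l\<close> and the direction. A largest
  \<open>S\<close> is taken; elements whose point is used by \<open>S\<close> and elements with a
  new point are counted separately, each kind contributing at most
  \<open>k * card S\<close>.\<close>

lemma large_compatible_subset:
  fixes p :: "'a \<Rightarrow> 'b" and q :: "'a \<Rightarrow> 'c" and d :: "'a \<Rightarrow> 'd"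
  assumes fin: "finite N"
    and pk: "\<And>a. card {x \<in> N. p x = a} \<le> k"
    and dk: "\<And>b. card (d ` {x \<in> N. q x = b}) \<le> k"
    and inj: "inj_on (\<lambda>x. (p x, d x)) N"
  obtains S where "S \<subseteq> N" "inj_on p S"
    "\<And>x y. x \<in> S \<Longrightarrow> y \<in> S \<Longrightarrow> q x = q y \<Longrightarrow> d x = d y"
    "card N \<le> 2 * k * card S"
proof -
  define compat where "compat S \<longleftrightarrow> S \<subseteq> N \<and> inj_on p S \<and>
    (\<forall>x\<in>S. \<forall>y\<in>S. q x = q y \<longrightarrow> d x = d y)" for S
  have "compat {}"
    by (simp add: compat_def)
  moreover have "\<forall>S. compat S \<longrightarrow> card S \<le> card N"
    using fin by (simp add: compat_def card_mono)
  ultimately obtain S where S: "compat S" and max: "\<And>T. compat T \<Longrightarrow> card T \<le> card S"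
    using ex_has_greatest_nat [of compat "{}" card "Suc (card N)"]
    by (auto simp: less_Suc_eq_le)
  have SN: "S \<subseteq> N" and finS: "finite S"
    using S fin finite_subset by (auto simp: compat_def)
  define H where "H = {x \<in> N. p x \<in> p ` S}"
  define U where "U = {x \<in> N. p x \<notin> p ` S}"
  \<comment> \<open>Replacing the members of \<open>S\<close> in plane \<open>b\<close> by all of
    \<open>U\<close> in that plane with direction \<open>e\<close> keeps the family compatible, so
    maximality of \<open>S\<close> forbids a gain.\<close>
  have swap: "card {x \<in> U. q x = b \<and> d x = e} \<le> card {x \<in> S. q x = b}" for b e
  proof -
    let ?A = "{x \<in> U. q x = b \<and> d x = e}" and ?B = "{x \<in> S. q x \<noteq> b}"
    have finA: "finite ?A"
      using fin by (simp add: U_def)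
    have "compat (?B \<union> ?A)"
      unfolding compat_def
    proof (intro conjI)
      show "?B \<union> ?A \<subseteq> N"
        using SN by (auto simp: U_def)
      \<comment> \<open>On \<open>?A\<close> the direction is constant, so injectivity of the pair
        leaves \<open>p\<close> injective.\<close>
      have "inj_on p ?A"
        using inj by (auto simp: inj_on_def U_def)
      moreover have "inj_on p ?B"
        using S by (auto simp: compat_def inj_on_def)
      moreover have "p ` ?B \<subseteq> p ` S" "p ` ?A \<inter> p ` S = {}"
        by (auto simp: U_def)
      ultimately show "inj_on p (?B \<union> ?A)"
        by (simp add: inj_on_Un) blast
      show "\<forall>x\<in>?B \<union> ?A. \<forall>y\<in>?B \<union> ?A. q x = q y \<longrightarrow> d x = d y"
      proof (intro ballI impI)
        fix x y
        assume xy: "x \<in> ?B \<union> ?A" "y \<in> ?B \<union> ?A" "q x = q y"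
        show "d x = d y"
        proof (cases "q x = b")
          case True
          with xy show ?thesis
            by simp
        next
          case False
          with xy have "x \<in> S" "y \<in> S"
            by simp_all
          with S xy(3) show ?thesis
            unfolding compat_def by blast
        qed
      qed
    qed
    then have "card (?B \<union> ?A) \<le> card S"
      by (rule max)
    moreover have "card (?B \<union> ?A) = card ?B + card ?A"
      using finS finA by (intro card_Un_disjoint) (simp, simp, blast)
    moreover have "card S = card ?B + card {x \<in> S. q x = b}"
      using card_Int_Diff [OF finS, of "{x. q x \<noteq> b}"] by (simp add: Int_def set_diff_eq)
    ultimately show ?thesis
      by linarith
  qed
  have plane: "card {x \<in> U. q x = b} \<le> k * card {x \<in> S. q x = b}" for b
  proof -
    let ?D = "d ` {x \<in> N. q x = b}"
    have "{x \<in> U. q x = b} = (\<Union>e\<in>?D. {x \<in> U. q x = b \<and> d x = e})"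
      by (auto simp: U_def)
    moreover have "finite ?D"
      using fin by simp
    ultimately have "card {x \<in> U. q x = b} \<le> (\<Sum>e\<in>?D. card {x \<in> U. q x = b \<and> d x = e})"
      by (simp only: card_UN_le)
    also have "\<dots> \<le> card ?D * card {x \<in> S. q x = b}"
      using sum_bounded_above [of ?D "\<lambda>e. card {x \<in> U. q x = b \<and> d x = e}"] swap by simp
    also have "\<dots> \<le> k * card {x \<in> S. q x = b}"
      using dk by (rule mult_le_mono1)
    finally show ?thesis .
  qed
  have fibres: "card A = (\<Sum>b\<in>q ` N. card {x \<in> A. q x = b})" if "A \<subseteq> N" for A
    using sum.group [of A "q ` N" q "\<lambda>_. 1::nat"] fin finite_subset [OF that fin] that
    by (auto simp: image_mono)
  have "card U = (\<Sum>b\<in>q ` N. card {x \<in> U. q x = b})"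
    by (rule fibres) (auto simp: U_def)
  also have "\<dots> \<le> (\<Sum>b\<in>q ` N. k * card {x \<in> S. q x = b})"
    by (intro sum_mono plane)
  also have "\<dots> = k * card S"
    using fibres [OF SN] by (simp add: sum_distrib_left)
  finally have cardU: "card U \<le> k * card S" .
  have "H = (\<Union>s\<in>S. {x \<in> N. p x = p s})"
    by (auto simp: H_def)
  then have "card H \<le> (\<Sum>s\<in>S. card {x \<in> N. p x = p s})"
    using finS by (simp add: card_UN_le)
  also have "\<dots> \<le> k * card S"
    using sum_bounded_above [of S "\<lambda>s. card {x \<in> N. p x = p s}" k] pk by (simp add: mult.commute)
  finally have cardH: "card H \<le> k * card S" .
  have "N = H \<union> U"
    by (auto simp: H_def U_def)
  then have "card N \<le> card H + card U"
    by (simp add: card_Un_le)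
  with cardU cardH have "card N \<le> 2 * k * card S"
    by simp
  moreover have "inj_on p S" "\<And>x y. x \<in> S \<Longrightarrow> y \<in> S \<Longrightarrow> q x = q y \<Longrightarrow> d x = d y"
    using S unfolding compat_def by blast+
  ultimately show ?thesis
    using SN by (intro that)
qed

section \<open>Lines, directions and planes\<close>

text \<open>For a line this is its one-dimensional direction space: it needs no choice of direction
  vector, and parallel lines get equal values.\<close>

definition directions :: "'a::ab_group_add set \<Rightarrow> 'a set" where
  "directions X = {a - b | a b. a \<in> X \<and> b \<in> X}"

lemma directions_line:
  "directions (range (\<lambda>t::real. a + t *\<^sub>R v)) = span {v}"
proof -
  have "u *\<^sub>R v \<in> directions (range (\<lambda>t::real. a + t *\<^sub>R v))" for u
    unfolding directions_def
    by (rule CollectI, rule exI [of _ "a + u *\<^sub>R v"], rule exI [of _ "a + 0 *\<^sub>R v"]) auto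
  then show ?thesis
    by (auto simp: directions_def span_singleton simp flip: scaleR_diff_left)
qed

text \<open>Shifting the parameter turns any point of a line into its base point.\<close>

lemma line_conv_directions:
  assumes "is_line x" "r \<in> x"
  shows "x = (\<lambda>w. r + w) ` directions x"
proof -
  obtain a v where x: "x = range (\<lambda>t::real. a + t *\<^sub>R v)"
    using assms(1) unfolding is_line_iff by blast
  obtain s where r: "r = a + s *\<^sub>R v"
    using assms(2) x by blast
  have "a + t *\<^sub>R v \<in> (\<lambda>w. r + w) ` range (\<lambda>t. t *\<^sub>R v)" for t
    unfolding r by (intro image_eqI [where x = "(t - s) *\<^sub>R v"] rangeI) (simp add: scaleR_diff_left)
  moreover have "r + t *\<^sub>R v \<in> x" for t
    unfolding x r by (rule range_eqI [of _ _ "s + t"]) (auto simp: algebra_simps)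
  ultimately show ?thesis
    unfolding x directions_line span_singleton by (auto simp: x)
qed

lemma lines_eq_if_common_point:
  assumes "is_line x" "is_line y" "directions x = directions y" "x \<inter> y \<noteq> {}"
  shows "x = y"
proof -
  obtain r where "r \<in> x" "r \<in> y"
    using assms(4) by blast
  then show ?thesis
    using line_conv_directions assms(1-3) by metis
qed

text \<open>The hull is an affine subset of the line of the same dimension.\<close>

lemma line_eq_affine_hull:
  assumes "is_line x" "a \<in> x" "b \<in> x" "a \<noteq> b"
  shows "x = affine hull {a, b}"
proof -
  have x: "affine x" "aff_dim x = 1"
    using assms(1) by (auto simp: is_line_def)
  have sub: "affine hull {a, b} \<subseteq> x"
    using x assms by (simp add: hull_minimal)
  have "aff_dim (affine hull {a, b}) = 1"
    using assms(4) by simp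
  then show ?thesis
    using affine_dim_equal [OF affine_affine_hull x(1) _ sub] x(2) by simp
qed

lemma lines_Int_eq_singleton:
  assumes "is_line x" "is_line y" "x \<noteq> y" "r \<in> x" "r \<in> y"
  shows "x \<inter> y = {r}"
  using line_eq_affine_hull assms by blast

text \<open>The line \<open>x\<close> is spanned by \<open>r\<close> and a point on
  \<open>l\<close>, so \<open>r\<close> alone fixes the plane. Hence two lines that meet
  \<open>l\<close> and share a point off \<open>l\<close> share their plane through
  \<open>l\<close>.\<close>

lemma affine_hull_line_Un:
  assumes "is_line l" "is_line x" "x \<inter> l \<noteq> {}" "r \<in> x" "r \<notin> l"
  shows "affine hull (l \<union> x) = affine hull (insert r l)"
proof -
  obtain s where s: "s \<in> x" "s \<in> l"
    using assms(3) by blast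
  have "x = affine hull {s, r}"
    using line_eq_affine_hull assms s by blast
  also have "\<dots> \<subseteq> affine hull (insert r l)"
    using s by (intro hull_mono) auto
  finally have "l \<union> x \<subseteq> affine hull (insert r l)"
    using hull_subset [of "insert r l" affine] by auto
  then have "affine hull (l \<union> x) \<subseteq> affine hull (insert r l)"
    by (simp add: hull_minimal)
  moreover have "affine hull (insert r l) \<subseteq> affine hull (l \<union> x)"
    using assms(4) by (intro hull_mono) auto
  ultimately show ?thesis
    by blast
qed

text \<open>Translating \<open>Q\<close> gives a subspace of dimension at most 2, spanned by the two
  independent direction vectors. The coefficients of \<open>b - a\<close> in them yield the
  parameters of a common point.\<close>

lemma coplanar_lines_meet:
  assumes x: "is_line x" "x \<subseteq> Q" and y: "is_line y" "y \<subseteq> Q"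
    and Q: "affine Q" "aff_dim Q \<le> 2" and dir: "directions x \<noteq> directions y"
  shows "x \<inter> y \<noteq> {}"
proof -
  obtain a v where v: "v \<noteq> 0" and xr: "x = range (\<lambda>t::real. a + t *\<^sub>R v)"
    using x(1) unfolding is_line_iff by blast
  obtain b w where w: "w \<noteq> 0" and yr: "y = range (\<lambda>t::real. b + t *\<^sub>R w)"
    using y(1) unfolding is_line_iff by blast
  define V where "V = (+) (- a) ` Q"
  have ax: "a \<in> x" "a + v \<in> x"
    unfolding xr by (auto intro: range_eqI [of _ _ 0] range_eqI [of _ _ 1])
  have bx: "b \<in> y" "b + w \<in> y"
    unfolding yr by (auto intro: range_eqI [of _ _ 0] range_eqI [of _ _ 1])
  have aQ: "a \<in> Q"
    using ax x by blast
  have sub: "subspace V"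
    unfolding V_def using affine_diffs_subspace [OF Q(1) aQ] by simp
  have dim: "dim V \<le> 2"
    using Q aff_dim_eq_dim [of a Q] aQ by (simp add: V_def hull_inc)
  have memV: "z - a \<in> V" if "z \<in> Q" for z
    using that by (auto simp: V_def)
  have vV: "v \<in> V"
    using memV [of "a + v"] ax x by auto
  have bV: "b - a \<in> V"
    using memV bx y by blast
  have "b + w - a \<in> V"
    using memV bx y by blast
  then have wV: "w \<in> V"
    using subspace_diff [OF sub _ bV] by fastforce
  have span: "span {v} \<noteq> span {w}"
    using dir unfolding xr yr directions_line .
  have vw: "v \<notin> span {w}"
  proof
    assume "v \<in> span {w}"
    then obtain t where t: "v = t *\<^sub>R w"
      by (auto simp: span_singleton)
    have "span {v} = span {w}"
      unfolding t using v t by (intro span_image_scale [of "{w}" "\<lambda>_. t", simplified]) auto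
    then show False
      using span by blast
  qed
  have ne: "v \<noteq> w"
    using vw by (auto simp: span_base)
  have "independent {v, w}"
    using vw w ne by (simp add: independent_insert)
  then have "V \<subseteq> span {v, w}"
    using card_ge_dim_independent [of "{v, w}" V] dim vV wV ne by simp
  then have "b - a \<in> span {v, w}"
    using bV by blast
  then obtain s t where "b - a = s *\<^sub>R v + t *\<^sub>R w"
    by (auto simp: span_insert span_singleton algebra_simps)
  then have "a + s *\<^sub>R v = b + (- t) *\<^sub>R w"
    by (simp add: algebra_simps)
  then show ?thesis
    unfolding xr yr by blast
qed

section \<open>Counting in the intersection graph\<close>

lemma intersection_graph_iff:
  assumes "x \<in> L" "y \<in> L" "x \<noteq> y"
  shows "{x, y} \<in> intersection_graph L \<longleftrightarrow> x \<inter> y \<noteq> {}"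
  using assms by (auto simp: intersection_graph_def doubleton_eq_iff)

text \<open>Applies \<open>large_compatible_subset\<close> with \<open>x \<inter> l\<close> as the
  point (a singleton here), \<open>affine hull (l \<union> x)\<close> as the plane and
  \<open>directions\<close> as the direction. The family obtained is independent, hence has at most
  \<open>k\<close> members.\<close>

lemma card_lines_meeting_line:
  fixes L :: "'a::euclidean_space set set"
  assumes fin: "finite L" and lines: "\<And>x. x \<in> L \<Longrightarrow> is_line x" and l: "l \<in> L"
    and bound: "\<And>S. S \<subseteq> L \<Longrightarrow>
      clique S (intersection_graph L) \<or> indep S (intersection_graph L) \<Longrightarrow> card S \<le> k"
  shows "card {x \<in> L. x \<noteq> l \<and> x \<inter> l \<noteq> {}} \<le> 2 * k * k"
proof -
  define N where "N = {x \<in> L. x \<noteq> l \<and> x \<inter> l \<noteq> {}}"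
  have finN: "finite N"
    using fin by (simp add: N_def)
  have NL: "N \<subseteq> L"
    by (auto simp: N_def)
  have ll: "is_line l"
    using lines l .
  have points: "card {x \<in> N. x \<inter> l = a} \<le> k" for a
  proof (rule bound)
    show "{x \<in> N. x \<inter> l = a} \<subseteq> L"
      using NL by auto
    have "clique {x \<in> N. x \<inter> l = a} (intersection_graph L)"
      unfolding clique_def
    proof (intro ballI impI)
      fix x y
      assume xy: "x \<in> {x \<in> N. x \<inter> l = a}" "y \<in> {x \<in> N. x \<inter> l = a}" "x \<noteq> y"
      then have "x \<inter> l \<noteq> {}" "x \<inter> l = y \<inter> l"
        unfolding N_def by blast+
      then have "x \<inter> y \<noteq> {}"
        by blast
      then show "{x, y} \<in> intersection_graph L"
        using intersection_graph_iff xy NL by blast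
    qed
    then show "clique {x \<in> N. x \<inter> l = a} (intersection_graph L) \<or>
        indep {x \<in> N. x \<inter> l = a} (intersection_graph L)" ..
  qed
  have dirs: "card (directions ` {x \<in> N. affine hull (l \<union> x) = Q}) \<le> k" for Q
  proof -
    \<comment> \<open>One line is chosen per direction in \<open>Q\<close>; these are coplanar and
      pairwise non-parallel, so they form a clique.\<close>
    obtain R where R: "R \<subseteq> {x \<in> N. affine hull (l \<union> x) = Q}" "inj_on directions R"
      "directions ` {x \<in> N. affine hull (l \<union> x) = Q} = directions ` R"
      using subset_image_inj [of "directions ` {x \<in> N. affine hull (l \<union> x) = Q}" directions
          "{x \<in> N. affine hull (l \<union> x) = Q}"] by auto
    have "clique R (intersection_graph L)"
      unfolding clique_def
    proof (intro ballI impI)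
      fix x y
      assume xy: "x \<in> R" "y \<in> R" "x \<noteq> y"
      have xN: "x \<in> N" "y \<in> N" and Q: "affine hull (l \<union> x) = Q" "affine hull (l \<union> y) = Q"
        using xy R by auto
      have lx: "is_line x" "is_line y"
        using xN NL lines by auto
      \<comment> \<open>A point of \<open>x\<close> off \<open>l\<close> shows that \<open>Q\<close>
        is the hull of \<open>l\<close> and one more point, hence of dimension at most 2.\<close>
      have "\<not> x \<subseteq> l"
        using xN lx ll affine_dim_equal [of x l] by (auto simp: N_def is_line_def)
      then obtain r where "r \<in> x" "r \<notin> l"
        by blast
      then have "Q = affine hull (insert r l)"
        using affine_hull_line_Un [OF ll lx(1)] xN Q by (simp add: N_def)
      then have dimQ: "aff_dim Q \<le> 2" and affQ: "affine Q"
        using ll by (auto simp: aff_dim_insert is_line_def)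
      have "x \<subseteq> Q" "y \<subseteq> Q"
        using hull_subset [of "l \<union> x" affine] hull_subset [of "l \<union> y" affine] Q by auto
      moreover have "directions x \<noteq> directions y"
        using R(2) xy by (auto simp: inj_on_def)
      ultimately have "x \<inter> y \<noteq> {}"
        using coplanar_lines_meet lx affQ dimQ by blast
      then show "{x, y} \<in> intersection_graph L"
        using intersection_graph_iff xy xN NL by blast
    qed
    moreover have "R \<subseteq> L"
      using R(1) NL by auto
    ultimately have "card R \<le> k"
      using bound by blast
    then show ?thesis
      using R by (simp add: card_image)
  qed
  have inj: "inj_on (\<lambda>x. (x \<inter> l, directions x)) N"
  proof (rule inj_onI)
    fix x y
    assume xy: "x \<in> N" "y \<in> N" "(x \<inter> l, directions x) = (y \<inter> l, directions y)"
    then have "x \<inter> l \<noteq> {}" "x \<inter> l = y \<inter> l" and dir: "directions x = directions y"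
      by (simp_all add: N_def)
    then have "x \<inter> y \<noteq> {}"
      by blast
    then show "x = y"
      using lines_eq_if_common_point lines xy(1,2) dir NL by blast
  qed
  obtain S where S: "S \<subseteq> N" "inj_on (\<lambda>x. x \<inter> l) S"
    "\<And>x y. x \<in> S \<Longrightarrow> y \<in> S \<Longrightarrow> affine hull (l \<union> x) = affine hull (l \<union> y) \<Longrightarrow>
      directions x = directions y"
    "card N \<le> 2 * k * card S"
    using large_compatible_subset [OF finN points dirs inj] by metis
  have "indep S (intersection_graph L)"
    unfolding indep_def
  proof (intro ballI impI)
    fix x y
    assume xy: "x \<in> S" "y \<in> S" "x \<noteq> y"
    have xN: "x \<in> N" "y \<in> N"
      using xy S by auto
    have lx: "is_line x" "is_line y"
      using xN NL lines by auto
    \<comment> \<open>A common point cannot lie on \<open>l\<close>, where \<open>x\<close> and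
      \<open>y\<close> have different points. Off \<open>l\<close> it forces equal planes, hence
      equal directions, hence \<open>x = y\<close>.\<close>
    have "x \<inter> y = {}"
    proof (rule ccontr)
      assume meet: "x \<inter> y \<noteq> {}"
      then obtain r where r: "r \<in> x" "r \<in> y"
        by blast
      have "x \<inter> l \<noteq> y \<inter> l"
        using S(2) xy by (auto simp: inj_on_def)
      then have "r \<notin> l"
        using r lx ll xN lines_Int_eq_singleton [of _ l r] by (auto simp: N_def)
      then have "affine hull (l \<union> x) = affine hull (l \<union> y)"
        using affine_hull_line_Un [OF ll] lx r xN by (simp add: N_def)
      then have "directions x = directions y"
        using S(3) xy by blast
      then show False
        using lines_eq_if_common_point lx meet xy by blast
    qed
    then show "{x, y} \<notin> intersection_graph L"
      using intersection_graph_iff xy xN NL by blast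
  qed
  then have "card S \<le> k"
    using bound S(1) NL by blast
  then have "2 * k * card S \<le> 2 * k * k"
    by simp
  then show ?thesis
    using S(4) unfolding N_def by linarith
qed

text \<open>The closed neighbourhoods of the members of a largest independent set \<open>I\<close>
  cover \<open>L\<close>, and each has at most \<open>2 * k * k + 1\<close> lines.\<close>

lemma card_lines_le:
  fixes L :: "'a::euclidean_space set set"
  assumes fin: "finite L" and lines: "\<And>x. x \<in> L \<Longrightarrow> is_line x"
    and bound: "\<And>S. S \<subseteq> L \<Longrightarrow>
      clique S (intersection_graph L) \<or> indep S (intersection_graph L) \<Longrightarrow> card S \<le> k"
  shows "card L \<le> 3 * k ^ 3"
proof -
  define ind where "ind S \<longleftrightarrow> S \<subseteq> L \<and> indep S (intersection_graph L)" for S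
  have "ind {}"
    by (simp add: ind_def indep_def)
  moreover have "\<forall>S. ind S \<longrightarrow> card S \<le> k"
    using bound by (auto simp: ind_def)
  ultimately obtain I where I: "ind I" and max: "\<And>T. ind T \<Longrightarrow> card T \<le> card I"
    using ex_has_greatest_nat [of ind "{}" card "Suc k"]
    by (auto simp: less_Suc_eq_le)
  have finI: "finite I"
    using I fin finite_subset by (auto simp: ind_def)
  define N where "N l = {x \<in> L. x \<noteq> l \<and> x \<inter> l \<noteq> {}}" for l
  \<comment> \<open>An uncovered line would be disjoint from all members of \<open>I\<close> and
    could be added to it.\<close>
  have "L \<subseteq> (\<Union>l\<in>I. insert l (N l))"
  proof (rule ccontr)
    assume "\<not> ?thesis"
    then obtain x where x: "x \<in> L" "x \<notin> I" "\<And>l. l \<in> I \<Longrightarrow> x \<inter> l = {}"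
      by (auto simp: N_def)
    have "{x, l} \<notin> intersection_graph L" if "l \<in> I" for l
      using that x I intersection_graph_iff [of x L l] by (auto simp: ind_def)
    then have "ind (insert x I)"
      using I x(1) by (auto simp: ind_def indep_def insert_commute)
    then have "card (insert x I) \<le> card I"
      by (rule max)
    then show False
      using x(2) finI by simp
  qed
  then have "card L \<le> card (\<Union>l\<in>I. insert l (N l))"
    using finI fin by (intro card_mono) (auto simp: N_def)
  also have "\<dots> \<le> (\<Sum>l\<in>I. card (insert l (N l)))"
    using finI by (rule card_UN_le)
  also have "\<dots> \<le> card I * (2 * k * k + 1)"
  proof -
    have "card (insert l (N l)) \<le> 2 * k * k + 1" if "l \<in> I" for l
    proof -
      have "card (N l) \<le> 2 * k * k"
        unfolding N_def using that I
        by (intro card_lines_meeting_line fin lines bound) (auto simp: ind_def)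
      then show ?thesis
        using card_insert_le_m1 [of "2 * k * k + 1" "N l" l] by simp
    qed
    then show ?thesis
      using sum_bounded_above [of I "\<lambda>l. card (insert l (N l))" "2 * k * k + 1"] by simp
  qed
  also have "\<dots> \<le> k * (2 * k * k + 1)"
    using bound I by (intro mult_le_mono1) (auto simp: ind_def)
  also have "\<dots> \<le> 3 * k ^ 3"
  proof -
    have "k \<le> k ^ 3"
      by (cases "k = 0") (auto intro: self_le_power)
    then show ?thesis
      by (simp add: algebra_simps power3_eq_cube)
  qed
  finally show ?thesis .
qed

theorem theorem15:
  shows "\<exists>c::real. c > 0 \<and>
    (\<forall>(n::nat) (L :: (real ^ 3) set set).
      finite L \<longrightarrow> card L = n \<longrightarrow> (\<forall>l\<in>L. is_line l) \<longrightarrow>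
      (\<exists>S. S \<subseteq> L \<and> real (card S) \<ge> c * real n powr (1/3) \<and>
        (clique S (intersection_graph L) \<or> indep S (intersection_graph L))))"
\<comment> \<open>The constant comes from rounding 3 up to the cube 8:
  \<open>n \<le> 3 * card S ^ 3 \<le> (2 * card S) ^ 3\<close> for a largest clique or independent
  set \<open>S\<close>.\<close>
proof (intro exI [of _ "1/2"] conjI allI impI)
  fix n :: nat and L :: "(real ^ 3) set set"
  assume fin: "finite L" and n: "card L = n" and lines: "\<forall>l\<in>L. is_line l"
  define hom where "hom S \<longleftrightarrow> S \<subseteq> L \<and>
    (clique S (intersection_graph L) \<or> indep S (intersection_graph L))" for S
  have "hom {}"
    by (simp add: hom_def indep_def)
  moreover have "\<forall>S. hom S \<longrightarrow> card S \<le> card L"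
    using fin by (simp add: hom_def card_mono)
  ultimately obtain S where S: "hom S" and max: "\<And>T. hom T \<Longrightarrow> card T \<le> card S"
    using ex_has_greatest_nat [of hom "{}" card "Suc (card L)"]
    by (auto simp: less_Suc_eq_le)
  have "n \<le> 3 * card S ^ 3"
    unfolding n [symmetric]
  proof (rule card_lines_le [OF fin])
    show "is_line x" if "x \<in> L" for x
      using lines that by blast
    show "card T \<le> card S"
      if "T \<subseteq> L" "clique T (intersection_graph L) \<or> indep T (intersection_graph L)" for T
      using that by (intro max) (simp add: hom_def)
  qed
  then have "n \<le> (2 * card S) ^ 3"
    by (simp add: power_mult_distrib)
  then have "real n \<le> (2 * real (card S)) ^ 3"
    unfolding of_nat_le_iff [where 'a = real, symmetric] by simp
  then have "real n powr (1/3) \<le> ((2 * real (card S)) ^ 3) powr (1/3)"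
    by (intro powr_mono2) auto
  also have "\<dots> = 2 * real (card S)"
    using root_powr_inverse [of 3 "(2 * real (card S)) ^ 3"] real_root_power_cancel [of 3 "2 * real (card S)"]
    by simp
  finally show "\<exists>S. S \<subseteq> L \<and> real (card S) \<ge> 1/2 * real n powr (1/3) \<and>
      (clique S (intersection_graph L) \<or> indep S (intersection_graph L))"
    using S unfolding hom_def by (intro exI [of _ S]) simp
qed simp

end
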